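(* Let $t_0\in\{0,\dots,T-1\}$, let $x_{t_0}\in\mathbb{X}_{t_0}$, and suppose that the data $b_{t_0},z_{t_0}\in\mathbb{R}^m$ of Problems (A) and (B) are linked by $b_{t_0}=z_{t_0}$. Then Problem (A) (with initial state $x_{t_0}$ and constraint level $b_{t_0}$) and Problem (B) (with initial states $x_{t_0}$ and $z_{t_0}$) are equivalent, in the sense that: (i) a solution $(\mathbf{U}^\flat,\mathbf{V}^\flat,\mathbf{X}^\flat,\mathbf{Z}^\flat)$ of Problem (B) can be deduced from a solution $(\mathbf{U}^\sharp,\mathbf{X}^\sharp)$ of Problem (A); (ii) the pair of components $(\mathbf{U}^\flat,\mathbf{X}^\flat)$ of a solution $(\mathbf{U}^\flat,\mathbf{V}^\flat,\mathbf{X}^\flat,\mathbf{Z}^\flat)$ of Problem (B) is a solution of Problem (A).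
   Context: Setting. $(\Omega,\mathcal{A},\mathbb{P})$ is a probability space, and $T>0$ and $m\ge 1$ are integers. $\mathbb{X}_0,\dots,\mathbb{X}_T$, $\mathbb{U}_0,\dots,\mathbb{U}_{T-1}$, $\mathbb{W}_1,\dots,\mathbb{W}_T$ are measurable spaces. The noise process is $\mathbf{W}=(\mathbf{W}_1,\dots,\mathbf{W}_T)$, with $\mathbf{W}_t$ a random variable with values in $\mathbb{W}_t$. The following maps are measurable: the dynamics $f_t:\mathbb{X}_t\times\mathbb{U}_t\times\mathbb{W}_{t+1}\to\mathbb{X}_{t+1}$ and the instantaneous costs $L_t:\mathbb{X}_t\times\mathbb{U}_t\times\mathbb{W}_{t+1}\to\mathbb{R}_+\cup\{+\infty\}$ for $t=0,\dots,T-1$, the final cost $K:\mathbb{X}_T\to\mathbb{R}_+\cup\{+\infty\}$, and $g:\mathbb{X}_T\to\mathbb{R}_+^m$. Inequalities in $\mathbb{R}^m$ are componentwise. $\sigma(\cdot)$ denotes the generated $\sigma$-field; for $t=t_0$, $\sigma(\mathbf{W}_{t_0+1},\dots,\mathbf{W}_t)$ is by convention the trivial $\sigma$-field $\{\emptyset,\Omega\}$. Problem (A): minimize, over processes $\mathbf{U}=(\mathbf{U}_{t_0},\dots,\mathbf{U}_{T-1})$ and $\mathbf{X}=(\mathbf{X}_{t_0},\dots,\mathbf{X}_T)$ of random variables with $\mathbf{U}_t$ valued in $\mathbb{U}_t$ and $\mathbf{X}_t$ valued in $\mathbb{X}_t$, the cost $$\mathbb{E}\Big[\sum_{t=t_0}^{T-1}L_t(\mathbf{X}_t,\mathbf{U}_t,\mathbf{W}_{t+1})+K(\mathbf{X}_T)\Big]$$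 subject to $\mathbf{X}_{t_0}=x_{t_0}$; $\mathbf{X}_{t+1}=f_t(\mathbf{X}_t,\mathbf{U}_t,\mathbf{W}_{t+1})$ and $\sigma(\mathbf{U}_t)\subset\sigma(\mathbf{W}_{t_0+1},\dots,\mathbf{W}_t)$ for all $t=t_0,\dots,T-1$; and $\mathbb{E}[g(\mathbf{X}_T)]-b_{t_0}\le 0$. Problem (B): minimize the same cost over $(\mathbf{U},\mathbf{V},\mathbf{X},\mathbf{Z})$, where $\mathbf{U},\mathbf{X}$ are as before and $\mathbf{V}=(\mathbf{V}_{t_0},\dots,\mathbf{V}_{T-1})$, $\mathbf{Z}=(\mathbf{Z}_{t_0},\dots,\mathbf{Z}_T)$ are processes with values in $\mathbb{R}^m$, subject, for all $t=t_0,\dots,T-1$, to: $\mathbf{X}_{t_0}=x_{t_0}$, $\mathbf{X}_{t+1}=f_t(\mathbf{X}_t,\mathbf{U}_t,\mathbf{W}_{t+1})$; $\mathbf{Z}_{t_0}=z_{t_0}$, $\mathbf{Z}_{t+1}=\mathbf{Z}_t+\mathbf{V}_t$; $\sigma(\mathbf{U}_t)\subset\sigma(\mathbf{W}_{t_0+1},\dots,\mathbf{W}_t)$; $\sigma(\mathbf{V}_t)\subset\sigma(\mathbf{W}_{t_0+1},\dots,\mathbf{W}_{t+1})$; $\mathbf{V}_t$ is integrable and $\mathbb{E}[\mathbf{V}_t\mid\sigma(\mathbf{W}_{t_0+1},\dots,\mathbf{W}_t)]=0$; and to the almost sure final constraint $g(\mathbf{X}_T)-\mathbf{Z}_T\le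 0$. A solution of a problem is an admissible point (one satisfying all constraints) whose cost is minimal among admissible points. Equalities, inequalities and conditional expectations of random variables are understood almost surely. *)

theory Defs
  imports "HOL-Probability.Probability"
begin

text \<open>
  Time-indexed spaces that may differ with the date are families of measurable spaces
  \<open>MX t\<close>, \<open>MU t\<close>, \<open>MW t\<close> over common ambient types; the spaces themselves are the carriers
  \<open>space (MX t)\<close> etc. Processes are functions on all of \<open>nat\<close>, constrained only at the relevant
  dates.
\<close>

text \<open>For \<open>t = t0\<close> the generating family is empty and the trivial sigma-field is obtained.\<close>

definition noise_field ::
  "'o measure \<Rightarrow> (nat \<Rightarrow> 'w measure) \<Rightarrow> (nat \<Rightarrow> 'o \<Rightarrow> 'w) \<Rightarrow> nat \<Rightarrow> nat \<Rightarrow> 'o measure" where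
  "noise_field M MW W t0 t =
     sigma (space M) (\<Union>s\<in>{t0<..t}. sets (vimage_algebra (space M) (W s) (MW s)))"

definition controlled_dynamics ::
  "'o measure \<Rightarrow> (nat \<Rightarrow> 'x measure) \<Rightarrow> (nat \<Rightarrow> 'u measure) \<Rightarrow> (nat \<Rightarrow> 'w measure) \<Rightarrow>
   (nat \<Rightarrow> 'o \<Rightarrow> 'w) \<Rightarrow> (nat \<Rightarrow> 'x \<Rightarrow> 'u \<Rightarrow> 'w \<Rightarrow> 'x) \<Rightarrow> nat \<Rightarrow> nat \<Rightarrow> 'x \<Rightarrow>
   (nat \<Rightarrow> 'o \<Rightarrow> 'u) \<Rightarrow> (nat \<Rightarrow> 'o \<Rightarrow> 'x) \<Rightarrow> bool" where
  "controlled_dynamics M MX MU MW W f T t0 x0 U X \<longleftrightarrow>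
     (\<forall>t\<in>{t0..<T}. U t \<in> measurable M (MU t)) \<and>
     (\<forall>t\<in>{t0..T}. X t \<in> measurable M (MX t)) \<and>
     (AE \<omega> in M. X t0 \<omega> = x0) \<and>
     (\<forall>t\<in>{t0..<T}. AE \<omega> in M. X (t + 1) \<omega> = f t (X t \<omega>) (U t \<omega>) (W (t + 1) \<omega>)) \<and>
     (\<forall>t\<in>{t0..<T}. sets (vimage_algebra (space M) (U t) (MU t)) \<subseteq> sets (noise_field M MW W t0 t))"

definition expected_cost ::
  "'o measure \<Rightarrow> (nat \<Rightarrow> 'o \<Rightarrow> 'w) \<Rightarrow> (nat \<Rightarrow> 'x \<Rightarrow> 'u \<Rightarrow> 'w \<Rightarrow> ennreal) \<Rightarrow> ('x \<Rightarrow> ennreal) \<Rightarrow>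
   nat \<Rightarrow> nat \<Rightarrow> (nat \<Rightarrow> 'o \<Rightarrow> 'u) \<Rightarrow> (nat \<Rightarrow> 'o \<Rightarrow> 'x) \<Rightarrow> ennreal" where
  "expected_cost M W L K T t0 U X =
     (\<integral>\<^sup>+\<omega>. (\<Sum>t=t0..<T. L t (X t \<omega>) (U t \<omega>) (W (t + 1) \<omega>)) + K (X T \<omega>) \<partial>M)"

text \<open>
  The order on \<open>real ^ 'm\<close> is the componentwise one. Since \<open>g\<close> is nonnegative, its expectation
  always exists in \<open>[0, \<infinity>]\<close>, and an infinite component violates the constraint; integrability has
  to be required explicitly because the Bochner integral of a non-integrable function is \<open>0\<close>.
\<close>

definition admissible_A ::
  "'o measure \<Rightarrow> (nat \<Rightarrow> 'x measure) \<Rightarrow> (nat \<Rightarrow> 'u measure) \<Rightarrow> (nat \<Rightarrow> 'w measure) \<Rightarrow>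
   (nat \<Rightarrow> 'o \<Rightarrow> 'w) \<Rightarrow> (nat \<Rightarrow> 'x \<Rightarrow> 'u \<Rightarrow> 'w \<Rightarrow> 'x) \<Rightarrow> ('x \<Rightarrow> real ^ 'm) \<Rightarrow> nat \<Rightarrow> nat \<Rightarrow> 'x \<Rightarrow>
   real ^ 'm \<Rightarrow> (nat \<Rightarrow> 'o \<Rightarrow> 'u) \<Rightarrow> (nat \<Rightarrow> 'o \<Rightarrow> 'x) \<Rightarrow> bool" where
  "admissible_A M MX MU MW W f g T t0 x0 b U X \<longleftrightarrow>
     controlled_dynamics M MX MU MW W f T t0 x0 U X \<and>
     integrable M (\<lambda>\<omega>. g (X T \<omega>)) \<and>
     (\<integral>\<omega>. g (X T \<omega>) \<partial>M) - b \<le> 0"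

text \<open>
  The conditional expectation of a random vector is taken componentwise, as the library only
  provides it for real random variables.
\<close>

definition admissible_B ::
  "'o measure \<Rightarrow> (nat \<Rightarrow> 'x measure) \<Rightarrow> (nat \<Rightarrow> 'u measure) \<Rightarrow> (nat \<Rightarrow> 'w measure) \<Rightarrow>
   (nat \<Rightarrow> 'o \<Rightarrow> 'w) \<Rightarrow> (nat \<Rightarrow> 'x \<Rightarrow> 'u \<Rightarrow> 'w \<Rightarrow> 'x) \<Rightarrow> ('x \<Rightarrow> real ^ 'm) \<Rightarrow> nat \<Rightarrow> nat \<Rightarrow> 'x \<Rightarrow>
   real ^ 'm \<Rightarrow> (nat \<Rightarrow> 'o \<Rightarrow> 'u) \<Rightarrow> (nat \<Rightarrow> 'o \<Rightarrow> real ^ 'm) \<Rightarrow> (nat \<Rightarrow> 'o \<Rightarrow> 'x) \<Rightarrow>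
   (nat \<Rightarrow> 'o \<Rightarrow> real ^ 'm) \<Rightarrow> bool" where
  "admissible_B M MX MU MW W f g T t0 x0 z0 U V X Z \<longleftrightarrow>
     controlled_dynamics M MX MU MW W f T t0 x0 U X \<and>
     (\<forall>t\<in>{t0..<T}. V t \<in> borel_measurable M) \<and>
     (\<forall>t\<in>{t0..T}. Z t \<in> borel_measurable M) \<and>
     (AE \<omega> in M. Z t0 \<omega> = z0) \<and>
     (\<forall>t\<in>{t0..<T}. AE \<omega> in M. Z (t + 1) \<omega> = Z t \<omega> + V t \<omega>) \<and>
     (\<forall>t\<in>{t0..<T}.
        sets (vimage_algebra (space M) (V t) borel) \<subseteq> sets (noise_field M MW W t0 (t + 1))) \<and>
     (\<forall>t\<in>{t0..<T}. integrable M (V t)) \<and>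
     (\<forall>t\<in>{t0..<T}. \<forall>i. AE \<omega> in M.
        real_cond_exp M (noise_field M MW W t0 t) (\<lambda>\<omega>'. V t \<omega>' $ i) \<omega> = 0) \<and>
     (AE \<omega> in M. g (X T \<omega>) - Z T \<omega> \<le> 0)"

definition solution_A ::
  "'o measure \<Rightarrow> (nat \<Rightarrow> 'x measure) \<Rightarrow> (nat \<Rightarrow> 'u measure) \<Rightarrow> (nat \<Rightarrow> 'w measure) \<Rightarrow>
   (nat \<Rightarrow> 'o \<Rightarrow> 'w) \<Rightarrow> (nat \<Rightarrow> 'x \<Rightarrow> 'u \<Rightarrow> 'w \<Rightarrow> 'x) \<Rightarrow> (nat \<Rightarrow> 'x \<Rightarrow> 'u \<Rightarrow> 'w \<Rightarrow> ennreal) \<Rightarrow>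
   ('x \<Rightarrow> ennreal) \<Rightarrow> ('x \<Rightarrow> real ^ 'm) \<Rightarrow> nat \<Rightarrow> nat \<Rightarrow> 'x \<Rightarrow> real ^ 'm \<Rightarrow>
   (nat \<Rightarrow> 'o \<Rightarrow> 'u) \<Rightarrow> (nat \<Rightarrow> 'o \<Rightarrow> 'x) \<Rightarrow> bool" where
  "solution_A M MX MU MW W f L K g T t0 x0 b U X \<longleftrightarrow>
     admissible_A M MX MU MW W f g T t0 x0 b U X \<and>
     (\<forall>U' X'. admissible_A M MX MU MW W f g T t0 x0 b U' X' \<longrightarrow>
        expected_cost M W L K T t0 U X \<le> expected_cost M W L K T t0 U' X')"

definition solution_B ::
  "'o measure \<Rightarrow> (nat \<Rightarrow> 'x measure) \<Rightarrow> (nat \<Rightarrow> 'u measure) \<Rightarrow> (nat \<Rightarrow> 'w measure) \<Rightarrow>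
   (nat \<Rightarrow> 'o \<Rightarrow> 'w) \<Rightarrow> (nat \<Rightarrow> 'x \<Rightarrow> 'u \<Rightarrow> 'w \<Rightarrow> 'x) \<Rightarrow> (nat \<Rightarrow> 'x \<Rightarrow> 'u \<Rightarrow> 'w \<Rightarrow> ennreal) \<Rightarrow>
   ('x \<Rightarrow> ennreal) \<Rightarrow> ('x \<Rightarrow> real ^ 'm) \<Rightarrow> nat \<Rightarrow> nat \<Rightarrow> 'x \<Rightarrow> real ^ 'm \<Rightarrow>
   (nat \<Rightarrow> 'o \<Rightarrow> 'u) \<Rightarrow> (nat \<Rightarrow> 'o \<Rightarrow> real ^ 'm) \<Rightarrow> (nat \<Rightarrow> 'o \<Rightarrow> 'x) \<Rightarrow>
   (nat \<Rightarrow> 'o \<Rightarrow> real ^ 'm) \<Rightarrow> bool" where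
  "solution_B M MX MU MW W f L K g T t0 x0 z0 U V X Z \<longleftrightarrow>
     admissible_B M MX MU MW W f g T t0 x0 z0 U V X Z \<and>
     (\<forall>U' V' X' Z'. admissible_B M MX MU MW W f g T t0 x0 z0 U' V' X' Z' \<longrightarrow>
        expected_cost M W L K T t0 U X \<le> expected_cost M W L K T t0 U' X')"

end

theory Submission
  imports Defs
begin

text \<open>
  The two admissible sets have the same projection on \<open>(U, X)\<close>, and the cost only depends on
  \<open>(U, X)\<close>. From \<open>(U, X)\<close> admissible in (A), let \<open>Z\<close> be \<open>z0\<close> plus the increments of the martingale
  \<open>E[g (X T) | noise up to t]\<close>. Along the dynamics \<open>X T\<close> is almost surely a function of the noise,
  so \<open>Z T = z0 + g (X T) - E[g (X T)] \<ge> g (X T)\<close>. Conversely \<open>Z\<close> is a martingale in (B), and taking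
  expectations in \<open>g (X T) \<le> Z T\<close> gives the constraint of (A).
\<close>

section \<open>Vector-valued functions treated component by component\<close>

text \<open>Expanding along the basis vectors reduces measurability and integrability of a vector
  built from scalar functions to closure under finite sums and products with constant
  vectors.\<close>

lemma vec_lambda_eq_sum_axis:
  fixes c :: "'m::finite \<Rightarrow> real"
  shows "(\<chi> i. c i) = (\<Sum>i\<in>UNIV. c i *\<^sub>R axis i 1)"
  by (simp add: vec_eq_iff axis_def if_distrib cong: if_cong)

lemma borel_measurable_vec_lambda:
  fixes h :: "'m::finite \<Rightarrow> 'a \<Rightarrow> real"
  assumes "\<And>i. h i \<in> borel_measurable N"
  shows "(\<lambda>x. \<chi> i. h i x) \<in> borel_measurable N"
  using assms unfolding vec_lambda_eq_sum_axis by measurable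

lemma borel_measurable_vec_nth:
  fixes h :: "'a \<Rightarrow> real ^ 'm"
  assumes "h \<in> borel_measurable N"
  shows "(\<lambda>x. h x $ i) \<in> borel_measurable N"
  by (rule measurable_compose[OF assms])
     (intro borel_measurable_continuous_onI continuous_intros)

lemma integrable_vec_lambda:
  fixes h :: "'m::finite \<Rightarrow> 'a \<Rightarrow> real"
  assumes "\<And>i. integrable N (h i)"
  shows "integrable N (\<lambda>x. \<chi> i. h i x)"
  unfolding vec_lambda_eq_sum_axis
  by (intro Bochner_Integration.integrable_sum integrable_scaleR_left assms)

lemma integrable_vec_nth:
  fixes h :: "'a \<Rightarrow> real ^ 'm"
  assumes "integrable N h"
  shows "integrable N (\<lambda>x. h x $ i)"
  by (rule integrable_bounded_linear[OF bounded_linear_vec_nth assms])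

lemma integral_vec_nth:
  fixes h :: "'a \<Rightarrow> real ^ 'm"
  assumes "integrable N h"
  shows "(\<integral>x. h x $ i \<partial>N) = (\<integral>x. h x \<partial>N) $ i"
  by (rule integral_bounded_linear[OF bounded_linear_vec_nth assms])

section \<open>The noise filtration and adapted versions of the state\<close>

text \<open>Turns the information constraints, stated as inclusions of generated sigma-fields, into
  measurability with respect to the smaller field. Measurability for \<open>M\<close> supplies that
  the values of \<open>h\<close> lie in \<open>space N\<close>.\<close>

lemma measurable_if_vimage_algebra_subset:
  assumes "h \<in> measurable M N" "space F = space M"
    and "sets (vimage_algebra (space M) h N) \<subseteq> sets F"
  shows "h \<in> measurable F N"
proof (rule measurableI)
  show "h x \<in> space N" if "x \<in> space F" for x
    using that assms(1,2) by (auto dest: measurable_space)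
  show "h -` A \<inter> space F \<in> sets F" if "A \<in> sets N" for A
    using in_vimage_algebra[OF that, of h "space M"] assms(2,3) by auto
qed

text \<open>\<open>sigma\<close> gives the field generated by a family provided that the family
  consists of subsets of the space; this is that side condition for
  \<open>noise_field\<close>.\<close>

lemma noise_generators_subset:
  "(\<Union>s\<in>{t0<..t}. sets (vimage_algebra (space M) (W s) (MW s))) \<subseteq> Pow (space M)"
  by (intro UN_least) (metis sets.space_closed space_vimage_algebra)

lemma space_noise_field [simp]: "space (noise_field M MW W t0 t) = space M"
  unfolding noise_field_def by (rule space_measure_of[OF noise_generators_subset])

lemma sets_noise_field:
  "sets (noise_field M MW W t0 t) =
     sigma_sets (space M) (\<Union>s\<in>{t0<..t}. sets (vimage_algebra (space M) (W s) (MW s)))"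
  unfolding noise_field_def by (rule sets_measure_of[OF noise_generators_subset])

lemma sets_noise_field_refl: "sets (noise_field M MW W t0 t0) = {{}, space M}"
  by (simp add: sets_noise_field sigma_sets_empty_eq)

lemma subalgebra_noise_field:
  assumes "\<And>s. s \<in> {t0<..t} \<Longrightarrow> W s \<in> measurable M (MW s)"
  shows "subalgebra M (noise_field M MW W t0 t)"
  unfolding subalgebra_def sets_noise_field
proof (intro conjI sets.sigma_sets_subset UN_least)
  show "sets (vimage_algebra (space M) (W s) (MW s)) \<subseteq> sets M" if "s \<in> {t0<..t}" for s
    by (intro sets_image_in_sets refl assms that)
qed simp

lemma sets_noise_field_mono:
  assumes "s \<le> t"
  shows "sets (noise_field M MW W t0 s) \<subseteq> sets (noise_field M MW W t0 t)"
  unfolding sets_noise_field using assms by (intro sigma_sets_mono' UN_mono) auto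

lemma measurable_noise_field_mono:
  assumes "s \<le> t" "h \<in> measurable (noise_field M MW W t0 s) N"
  shows "h \<in> measurable (noise_field M MW W t0 t) N"
  using assms sets_noise_field_mono[OF assms(1), of M MW W t0] unfolding measurable_def by auto

lemma measurable_noise:
  assumes "s \<in> {t0<..t}" "W s \<in> measurable M (MW s)"
  shows "W s \<in> measurable (noise_field M MW W t0 t) (MW s)"
  using assms by (intro measurable_if_vimage_algebra_subset[OF assms(2)])
    (auto simp: sets_noise_field intro!: sigma_sets.Basic)

text \<open>
  The state itself need not be adapted, as the dynamics only hold almost surely; a version of it is.
\<close>

lemma controlled_dynamics_adapted_version:
  assumes W: "\<And>t. t \<in> {1..T} \<Longrightarrow> W t \<in> measurable M (MW t)"
    and f: "\<And>t. t < T \<Longrightarrow>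
      (\<lambda>(x, u, w). f t x u w) \<in> measurable (MX t \<Otimes>\<^sub>M MU t \<Otimes>\<^sub>M MW (t + 1)) (MX (t + 1))"
    and x0: "x0 \<in> space (MX t0)"
    and dyn: "controlled_dynamics M MX MU MW W f T t0 x0 U X"
    and t: "t0 \<le> t" "t \<le> T"
  shows "\<exists>Y \<in> measurable (noise_field M MW W t0 t) (MX t). AE \<omega> in M. X t \<omega> = Y \<omega>"
  using t
proof (induction t rule: dec_induct)
  case base
  have "(\<lambda>\<omega>. x0) \<in> measurable (noise_field M MW W t0 t0) (MX t0)" using x0 by simp
  moreover have "AE \<omega> in M. X t0 \<omega> = x0"
    using dyn by (simp add: controlled_dynamics_def)
  ultimately show ?case by (intro bexI[of _ "\<lambda>\<omega>. x0"])
next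
  case (step s)
  let ?F = "noise_field M MW W t0"
  have s: "s \<in> {t0..<T}" using step by auto
  obtain Y where Y: "Y \<in> measurable (?F s) (MX s)" "AE \<omega> in M. X s \<omega> = Y \<omega>"
  proof -
    have "s \<le> T" using s by simp
    from step.IH[OF this] that show thesis by blast
  qed
  \<comment> \<open>The information constraint makes \<open>U s\<close> measurable for the field at
    \<open>s\<close>. Both \<open>U s\<close> and \<open>Y\<close> are then lifted to the field at
    \<open>Suc s\<close>, which also contains \<open>W (s + 1)\<close>, the noise that drives the
    transition to \<open>X (Suc s)\<close>.\<close>
  have "U s \<in> measurable (?F s) (MU s)"
    by (rule measurable_if_vimage_algebra_subset[of _ M])
      (use dyn s in \<open>simp_all add: controlled_dynamics_def\<close>)
  then have U [measurable]: "U s \<in> measurable (?F (Suc s)) (MU s)"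
    by (rule measurable_noise_field_mono[rotated]) simp
  have Y' [measurable]: "Y \<in> measurable (?F (Suc s)) (MX s)"
    by (rule measurable_noise_field_mono[OF _ Y(1)]) simp
  have W' [measurable]: "W (s + 1) \<in> measurable (?F (Suc s)) (MW (s + 1))"
    by (rule measurable_noise) (use W s in auto)
  have "(\<lambda>\<omega>. (Y \<omega>, U s \<omega>, W (s + 1) \<omega>))
      \<in> measurable (?F (Suc s)) (MX s \<Otimes>\<^sub>M MU s \<Otimes>\<^sub>M MW (s + 1))"
    by measurable
  from measurable_compose[OF this f] s
  have "(\<lambda>\<omega>. f s (Y \<omega>) (U s \<omega>) (W (s + 1) \<omega>)) \<in> measurable (?F (Suc s)) (MX (Suc s))"
    by simp
  moreover have "AE \<omega> in M. X (s + 1) \<omega> = f s (X s \<omega>) (U s \<omega>) (W (s + 1) \<omega>)"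
    using dyn s unfolding controlled_dynamics_def by blast
  then have "AE \<omega> in M. X (Suc s) \<omega> = f s (Y \<omega>) (U s \<omega>) (W (s + 1) \<omega>)"
    using Y(2) by eventually_elim simp
  ultimately show ?case by (intro bexI[of _ "\<lambda>\<omega>. f s (Y \<omega>) (U s \<omega>) (W (s + 1) \<omega>)"])
qed

section \<open>From (A) to (B): completing by a martingale\<close>

text \<open>At \<open>t0\<close> the field is trivial, so the characterization of conditional
  expectation has to be tested on the empty set and the whole space alone; on the latter it holds
  because the total mass is 1.\<close>

lemma (in prob_space) real_cond_exp_noise_field_refl:
  assumes "integrable M h"
  shows "AE \<omega> in M. real_cond_exp M (noise_field M MW W t0 t0) h \<omega> = expectation h"
proof -
  interpret finite_measure_subalgebra M "noise_field M MW W t0 t0"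
    by unfold_locales (rule subalgebra_noise_field, simp)
  show ?thesis
  proof (rule real_cond_exp_charact)
    show "(\<integral>\<omega>\<in>A. h \<omega> \<partial>M) = (\<integral>\<omega>\<in>A. expectation h \<partial>M)"
      if "A \<in> sets (noise_field M MW W t0 t0)" for A
      using that set_integral_space[OF assms] set_integral_space[of M "\<lambda>_. expectation h"] prob_space
      by (auto simp: sets_noise_field_refl) (simp_all add: set_lebesgue_integral_def)
  qed (use assms in auto)
qed

lemma (in prob_space) admissible_B_of_admissible_A:
  fixes g :: "'x \<Rightarrow> real ^ 'm"
  assumes W: "\<And>t. t \<in> {1..T} \<Longrightarrow> W t \<in> measurable M (MW t)"
    and f: "\<And>t. t < T \<Longrightarrow>
      (\<lambda>(x, u, w). f t x u w) \<in> measurable (MX t \<Otimes>\<^sub>M MU t \<Otimes>\<^sub>M MW (t + 1)) (MX (t + 1))"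
    and g: "g \<in> borel_measurable (MX T)"
    and t0: "t0 \<le> T"
    and x0: "x0 \<in> space (MX t0)"
    and A: "admissible_A M MX MU MW W f g T t0 x0 z0 U X"
  shows "\<exists>V Z. admissible_B M MX MU MW W f g T t0 x0 z0 U V X Z"
proof -
  define F where "F = noise_field M MW W t0"
  define E where "E i t = real_cond_exp M (F t) (\<lambda>\<omega>. g (X T \<omega>) $ i)" for i t
  \<comment> \<open>The increment of the martingale over the step from \<open>t\<close> to
    \<open>Suc t\<close>: it is measurable for the field at \<open>t + 1\<close>, and conditioning
    on the field at \<open>t\<close> annihilates it.\<close>
  define V where "V t \<omega> = (\<chi> i. E i (Suc t) \<omega> - E i t \<omega>)" for t \<omega>
  \<comment> \<open>The increments summed in closed form. Subtracting \<open>E i t0\<close> instead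
    of the constant expectation makes the initial condition and the recursion for \<open>Z\<close>
    hold at every point.\<close>
  define Z where "Z t \<omega> = z0 + (\<chi> i. E i t \<omega> - E i t0 \<omega>)" for t \<omega>
  have dyn: "controlled_dynamics M MX MU MW W f T t0 x0 U X"
    and gX: "integrable M (\<lambda>\<omega>. g (X T \<omega>))"
    and le: "(\<integral>\<omega>. g (X T \<omega>) \<partial>M) \<le> z0"
    using A by (simp_all add: admissible_A_def)
  have gXi: "integrable M (\<lambda>\<omega>. g (X T \<omega>) $ i)" for i
    by (rule integrable_vec_nth[OF gX])
  have sub: "subalgebra M (F t)" if "t \<le> T" for t
    unfolding F_def using that by (intro subalgebra_noise_field W) auto
  have fms: "finite_measure_subalgebra M (F t)" if "t \<le> T" for t
    by unfold_locales (rule sub[OF that])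
  have sfs: "sigma_finite_subalgebra M (F t)" if "t \<le> T" for t
    by (rule finite_measure_subalgebra_is_sigma_finite[OF fms[OF that]])
  have intE: "integrable M (E i t)" if "t \<le> T" for i t
    unfolding E_def by (rule sigma_finite_subalgebra.real_cond_exp_int(1)[OF sfs[OF that] gXi])
  have measE: "E i t \<in> borel_measurable (F t)" for i t
    unfolding E_def by simp
  have measE': "E i t \<in> borel_measurable M" for i t
    unfolding E_def by simp
  have V_cond: "AE \<omega> in M. real_cond_exp M (F t) (\<lambda>\<omega>'. V t \<omega>' $ i) \<omega> = 0" if t: "t < T" for t i
  proof -
    interpret sigma_finite_subalgebra M "F t" using sfs t by simp
    have "subalgebra (F (Suc t)) (F t)"
      by (simp add: F_def subalgebra_def sets_noise_field_mono)
    \<comment> \<open>Tower property for the nested fields at \<open>t\<close> and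
      \<open>Suc t\<close>; the term \<open>E i t\<close>, already measurable at time
      \<open>t\<close>, is left unchanged by the conditioning, and the two cancel.\<close>
    then have "AE \<omega> in M. real_cond_exp M (F t) (E i (Suc t)) \<omega> = E i t \<omega>"
      unfolding E_def using sub[of "Suc t"] t gXi by (intro real_cond_exp_nested_subalg) auto
    moreover have "AE \<omega> in M. real_cond_exp M (F t) (E i t) \<omega> = E i t \<omega>"
      using intE[of t] measE t by (intro real_cond_exp_F_meas) auto
    moreover have "AE \<omega> in M. real_cond_exp M (F t) (\<lambda>\<omega>. E i (Suc t) \<omega> - E i t \<omega>) \<omega> =
        real_cond_exp M (F t) (E i (Suc t)) \<omega> - real_cond_exp M (F t) (E i t) \<omega>"
      using intE t by (intro real_cond_exp_diff) auto
    ultimately show ?thesis unfolding V_def by eventually_elim simp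
  qed
  have measV: "V t \<in> borel_measurable (F (t + 1))" for t
  proof -
    have "E i t \<in> borel_measurable (F (Suc t))" for i
      using measE[of i t] unfolding F_def by (rule measurable_noise_field_mono[rotated]) simp
    then show ?thesis
      unfolding V_def using measE by (intro borel_measurable_vec_lambda) (auto intro: borel_measurable_diff)
  qed
  have "AE \<omega> in M. E i T \<omega> = g (X T \<omega>) $ i" for i
  proof -
    interpret sigma_finite_subalgebra M "F T" using sfs by simp
    \<comment> \<open>Conditioning fixes functions that are measurable for the field, whereas
      \<open>X T\<close> is only almost surely equal to such a function. Hence the detour through
      \<open>g (Y \<omega>)\<close>, which is then transferred back along the almost sure
      equality.\<close>
    obtain Y where Y: "Y \<in> measurable (F T) (MX T)" "AE \<omega> in M. X T \<omega> = Y \<omega>"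
    proof -
      have "\<exists>Y \<in> measurable (F T) (MX T). AE \<omega> in M. X T \<omega> = Y \<omega>"
        unfolding F_def
        by (rule controlled_dynamics_adapted_version[where MU = MU and f = f and U = U])
          (fact W f x0 dyn t0 order_refl)+
      then show thesis using that by blast
    qed
    have gY: "(\<lambda>\<omega>. g (Y \<omega>) $ i) \<in> borel_measurable (F T)"
      by (intro borel_measurable_vec_nth measurable_compose[OF Y(1) g])
    then have gY': "(\<lambda>\<omega>. g (Y \<omega>) $ i) \<in> borel_measurable M"
      by (rule measurable_from_subalg[OF subalg])
    have eq: "AE \<omega> in M. g (X T \<omega>) $ i = g (Y \<omega>) $ i"
      using Y(2) by eventually_elim simp
    have "integrable M (\<lambda>\<omega>. g (Y \<omega>) $ i)"
      by (rule integrable_cong_AE_imp[OF gXi gY']) (use eq in eventually_elim, simp)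
    then have "AE \<omega> in M. real_cond_exp M (F T) (\<lambda>\<omega>. g (Y \<omega>) $ i) \<omega> = g (Y \<omega>) $ i"
      by (rule real_cond_exp_F_meas[OF _ gY])
    moreover have "AE \<omega> in M. E i T \<omega> = real_cond_exp M (F T) (\<lambda>\<omega>. g (Y \<omega>) $ i) \<omega>"
      unfolding E_def using gXi gY' by (intro real_cond_exp_cong eq) auto
    ultimately show ?thesis using eq by eventually_elim simp
  qed
  \<comment> \<open>There are finitely many components, so their exceptional null sets can be merged
    into one.\<close>
  then have "AE \<omega> in M. \<forall>i. E i T \<omega> = g (X T \<omega>) $ i"
    by (simp add: AE_all_countable)
  moreover have "AE \<omega> in M. E i t0 \<omega> = (\<integral>\<omega>. g (X T \<omega>) \<partial>M) $ i" for i
    using real_cond_exp_noise_field_refl[OF gXi, of MW W t0 i] integral_vec_nth[OF gX, of i]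
    by (simp add: E_def F_def)
  then have "AE \<omega> in M. \<forall>i. E i t0 \<omega> = (\<integral>\<omega>. g (X T \<omega>) \<partial>M) $ i"
    by (simp add: AE_all_countable)
  ultimately have final: "AE \<omega> in M. g (X T \<omega>) - Z T \<omega> \<le> 0"
    by eventually_elim (use le in \<open>simp add: Z_def less_eq_vec_def\<close>)
  have "admissible_B M MX MU MW W f g T t0 x0 z0 U V X Z"
    unfolding admissible_B_def
  proof (intro conjI ballI allI)
    fix t assume t: "t \<in> {t0..<T}"
    show "V t \<in> borel_measurable M"
      using measurable_from_subalg[OF sub measV[of t]] t by simp
    show "AE \<omega> in M. Z (t + 1) \<omega> = Z t \<omega> + V t \<omega>"
      by (simp add: Z_def V_def vec_eq_iff)
    show "sets (vimage_algebra (space M) (V t) borel) \<subseteq> sets (noise_field M MW W t0 (t + 1))"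
      using measV[of t] by (intro sets_image_in_sets) (simp_all add: F_def)
    show "integrable M (V t)"
      unfolding V_def using t by (intro integrable_vec_lambda Bochner_Integration.integrable_diff intE) auto
    show "AE \<omega> in M. real_cond_exp M (noise_field M MW W t0 t) (\<lambda>\<omega>'. V t \<omega>' $ i) \<omega> = 0" for i
      using V_cond t by (simp add: F_def)
  next
    show "Z t \<in> borel_measurable M" for t
      unfolding Z_def
      by (intro borel_measurable_add borel_measurable_const borel_measurable_vec_lambda
          borel_measurable_diff measE')
    show "AE \<omega> in M. Z t0 \<omega> = z0"
      by (simp add: Z_def vec_eq_iff)
  qed (fact dyn final)+
  then show ?thesis by blast
qed

section \<open>From (B) to (A): taking expectations\<close>

lemma (in prob_space) admissible_A_of_admissible_B:
  fixes g :: "'x \<Rightarrow> real ^ 'm"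
  assumes W: "\<And>t. t \<in> {1..T} \<Longrightarrow> W t \<in> measurable M (MW t)"
    and g: "g \<in> borel_measurable (MX T)"
    and g_nonneg: "\<And>x. x \<in> space (MX T) \<Longrightarrow> 0 \<le> g x"
    and t0: "t0 \<le> T"
    and B: "admissible_B M MX MU MW W f g T t0 x0 z0 U V X Z"
  shows "admissible_A M MX MU MW W f g T t0 x0 z0 U X"
proof -
  let ?F = "noise_field M MW W t0"
  have dyn: "controlled_dynamics M MX MU MW W f T t0 x0 U X"
    and Zmeas: "\<And>t. t \<in> {t0..T} \<Longrightarrow> Z t \<in> borel_measurable M"
    and Z0: "AE \<omega> in M. Z t0 \<omega> = z0"
    and Zstep: "\<And>t. t \<in> {t0..<T} \<Longrightarrow> AE \<omega> in M. Z (t + 1) \<omega> = Z t \<omega> + V t \<omega>"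
    and Vint: "\<And>t. t \<in> {t0..<T} \<Longrightarrow> integrable M (V t)"
    and Vcond: "\<And>t i. t \<in> {t0..<T} \<Longrightarrow>
      AE \<omega> in M. real_cond_exp M (?F t) (\<lambda>\<omega>'. V t \<omega>' $ i) \<omega> = 0"
    and final: "AE \<omega> in M. g (X T \<omega>) - Z T \<omega> \<le> 0"
    using B by (auto simp: admissible_B_def)
  have V0: "expectation (V t) = 0" if t: "t \<in> {t0..<T}" for t
  proof (simp only: vec_eq_iff, intro allI)
    fix i
    interpret finite_measure_subalgebra M "?F t"
      by unfold_locales (rule subalgebra_noise_field, use W t in auto)
    \<comment> \<open>A conditional expectation has the same mean as the variable itself, so a zero
      conditional mean forces a zero mean.\<close>
    have "expectation (V t) $ i = (\<integral>\<omega>. V t \<omega> $ i \<partial>M)"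
      by (rule integral_vec_nth[OF Vint[OF t], symmetric])
    also have "\<dots> = (\<integral>\<omega>. real_cond_exp M (?F t) (\<lambda>\<omega>. V t \<omega> $ i) \<omega> \<partial>M)"
      by (rule real_cond_exp_int(2)[OF integrable_vec_nth[OF Vint[OF t]], symmetric])
    also have "\<dots> = (\<integral>\<omega>. 0 \<partial>M)"
      using Vcond[OF t] by (intro integral_cong_AE) auto
    finally show "expectation (V t) $ i = 0 $ i" by simp
  qed
  \<comment> \<open>Zero-mean increments keep the mean at its initial value \<open>z0\<close>.
    Integrability is carried through the induction because additivity of the Bochner integral
    requires it.\<close>
  have Z: "integrable M (Z t) \<and> expectation (Z t) = z0" if "t0 \<le> t" "t \<le> T" for t
    using that
  proof (induction t rule: dec_induct)
    case base
    have Zm: "Z t0 \<in> borel_measurable M" using Zmeas t0 by simp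
    have "integrable M (Z t0)"
      by (rule integrable_cong_AE_imp[of _ "\<lambda>_. z0"]) (use Zm Z0 in \<open>auto simp: eq_commute\<close>)
    moreover have "expectation (Z t0) = (\<integral>\<omega>. z0 \<partial>M)"
      by (rule integral_cong_AE) (use Zm Z0 in auto)
    ultimately show ?case by (simp add: prob_space)
  next
    case (step s)
    then have s: "s \<in> {t0..<T}" by auto
    have Zm: "Z (Suc s) \<in> borel_measurable M" using Zmeas s by simp
    have eq: "AE \<omega> in M. Z (Suc s) \<omega> = Z s \<omega> + V s \<omega>" using Zstep[OF s] by simp
    have int: "integrable M (\<lambda>\<omega>. Z s \<omega> + V s \<omega>)"
      using step Vint[OF s] by auto
    have "integrable M (Z (Suc s))"
      by (rule integrable_cong_AE_imp[OF int Zm]) (use eq in eventually_elim, simp)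
    moreover have "expectation (Z (Suc s)) = (\<integral>\<omega>. Z s \<omega> + V s \<omega> \<partial>M)"
      using Zm int eq by (intro integral_cong_AE) auto
    ultimately show ?case
      using step Vint[OF s] V0[OF s] by simp
  qed
  then have ZT: "integrable M (Z T)" "expectation (Z T) = z0"
    using t0 by auto
  have XT: "X T \<in> measurable M (MX T)"
    using dyn t0 by (simp add: controlled_dynamics_def)
  have le: "AE \<omega> in M. g (X T \<omega>) \<le> Z T \<omega>"
    using final by eventually_elim simp
  \<comment> \<open>Nonnegativity of \<open>g\<close> turns the one-sided bound
    \<open>g (X T) \<le> Z T\<close> into domination in norm. This yields the integrability demanded
    in (A), without which the comparison of integrals would not be available.\<close>
  have "AE \<omega> in M. norm (g (X T \<omega>)) \<le> norm (Z T \<omega>)"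
    using le AE_space
  proof eventually_elim
    case (elim \<omega>)
    then have "0 \<le> g (X T \<omega>)" using XT g_nonneg by (auto dest: measurable_space)
    with elim show ?case
      by (intro norm_le_componentwise_cart) (auto simp: less_eq_vec_def intro: order_trans)
  qed
  then have gX: "integrable M (\<lambda>\<omega>. g (X T \<omega>))"
    by (rule Bochner_Integration.integrable_bound[OF ZT(1) measurable_compose[OF XT g]])
  have "expectation (\<lambda>\<omega>. g (X T \<omega>)) $ i \<le> z0 $ i" for i
  proof -
    have "(\<integral>\<omega>. g (X T \<omega>) $ i \<partial>M) \<le> (\<integral>\<omega>. Z T \<omega> $ i \<partial>M)"
      using le by (intro integral_mono_AE integrable_vec_nth gX ZT(1))
        (auto simp: less_eq_vec_def)
    then show ?thesis
      using ZT by (simp add: integral_vec_nth gX)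
  qed
  then have "expectation (\<lambda>\<omega>. g (X T \<omega>)) - z0 \<le> 0"
    by (simp add: less_eq_vec_def)
  with dyn gX show ?thesis by (simp add: admissible_A_def)
qed

section \<open>Equivalence of the two problems\<close>

theorem mainTheorem1:
  fixes M :: "'o measure"
    and MX :: "nat \<Rightarrow> 'x measure" and MU :: "nat \<Rightarrow> 'u measure" and MW :: "nat \<Rightarrow> 'w measure"
    and W :: "nat \<Rightarrow> 'o \<Rightarrow> 'w"
    and f :: "nat \<Rightarrow> 'x \<Rightarrow> 'u \<Rightarrow> 'w \<Rightarrow> 'x"
    and L :: "nat \<Rightarrow> 'x \<Rightarrow> 'u \<Rightarrow> 'w \<Rightarrow> ennreal"
    and K :: "'x \<Rightarrow> ennreal"
    and g :: "'x \<Rightarrow> real ^ 'm"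
    and T t0 :: nat and x0 :: 'x and b z0 :: "real ^ 'm"
  assumes "prob_space M"
    and "T > 0"
    and "\<And>t. t \<in> {1..T} \<Longrightarrow> W t \<in> measurable M (MW t)"
    and "\<And>t. t < T \<Longrightarrow>
      (\<lambda>(x, u, w). f t x u w) \<in> measurable (MX t \<Otimes>\<^sub>M MU t \<Otimes>\<^sub>M MW (t + 1)) (MX (t + 1))"
    and "\<And>t. t < T \<Longrightarrow>
      (\<lambda>(x, u, w). L t x u w) \<in> borel_measurable (MX t \<Otimes>\<^sub>M MU t \<Otimes>\<^sub>M MW (t + 1))"
    and "K \<in> borel_measurable (MX T)"
    and "g \<in> borel_measurable (MX T)"
    and "\<And>x. x \<in> space (MX T) \<Longrightarrow> 0 \<le> g x"
    and "t0 \<in> {0..T - 1}"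
    and "x0 \<in> space (MX t0)"
    and "b = z0"
  shows "(\<forall>U X. solution_A M MX MU MW W f L K g T t0 x0 b U X \<longrightarrow>
            (\<exists>V Z. solution_B M MX MU MW W f L K g T t0 x0 z0 U V X Z)) \<and>
         (\<forall>U V X Z. solution_B M MX MU MW W f L K g T t0 x0 z0 U V X Z \<longrightarrow>
            solution_A M MX MU MW W f L K g T t0 x0 b U X)"
proof -
  interpret prob_space M by fact
  have t0: "t0 \<le> T" using assms(9) by simp
  have AB: "\<exists>V Z. admissible_B M MX MU MW W f g T t0 x0 z0 U V X Z"
    if "admissible_A M MX MU MW W f g T t0 x0 b U X" for U X
    using that unfolding assms(11)
    by (rule admissible_B_of_admissible_A[rotated -1]) (fact assms t0)+
  have BA: "admissible_A M MX MU MW W f g T t0 x0 b U X"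
    if "admissible_B M MX MU MW W f g T t0 x0 z0 U V X Z" for U V X Z
    using that unfolding assms(11)
    by (rule admissible_A_of_admissible_B[rotated -1]) (fact assms t0)+
  show ?thesis
    \<comment> \<open>For (i), \<open>AB\<close> completes the solution and \<open>BA\<close>
      projects every competitor in (B) to one in (A) of equal cost. For (ii), \<open>BA\<close>
      projects the solution and \<open>AB\<close> lifts every competitor in (A).\<close>
    unfolding solution_A_def solution_B_def using AB BA by meson
qed

end
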